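(* The group of all rational bilipschitz homeomorphisms of $\{0,1\}^\omega$ is simple but not finitely generated.
   Context: Let $\{0,1\}^\omega$ be the Cantor set of infinite binary sequences, with its standard metric (e.g. $d(\psi,\phi)=2^{-n}$ where $n$ is the length of the longest common prefix of $\psi\neq\phi$). An asynchronous binary transducer is a quadruple $(S,s_0,t,o)$ with $S$ a finite set of states, $s_0\in S$, $t\colon S\times\{0,1\}\to S$ and $o\colon S\times\{0,1\}\to\{0,1\}^*$ (finite binary words). For a state $s$ and a sequence $\sigma_1\sigma_2\cdots$, define $s_1=s$, $s_{n+1}=t(s_n,\sigma_n)$, and $o(s,\sigma_1\sigma_2\cdots)=o(s_1,\sigma_1)o(s_2,\sigma_2)\cdots$. A homeomorphism $f$ of $\{0,1\}^\omega$ is rational if some such transducer satisfies $f(\psi)=o(s_0,\psi)$ for all $\psi$. A homeomorphism is bilipschitz if it and its inverse are Lipschitz. *)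

theory Defs
  imports Complex_Main "HOL-Algebra.Generated_Groups"
begin

type_synonym cantor = "nat \<Rightarrow> bool"

definition cdist :: "cantor \<Rightarrow> cantor \<Rightarrow> real" where
  "cdist x y = (if x = y then 0 else (1/2) ^ (LEAST n. x n \<noteq> y n))"

definition cantor_continuous :: "(cantor \<Rightarrow> cantor) \<Rightarrow> bool" where
  "cantor_continuous f \<longleftrightarrow>
     (\<forall>x. \<forall>e>0. \<exists>d>0. \<forall>y. cdist x y < d \<longrightarrow> cdist (f x) (f y) < e)"

definition cantor_homeomorphism :: "(cantor \<Rightarrow> cantor) \<Rightarrow> bool" where
  "cantor_homeomorphism f \<longleftrightarrow> bij f \<and> cantor_continuous f \<and> cantor_continuous (inv_into UNIV f)"

definition cantor_lipschitz :: "(cantor \<Rightarrow> cantor) \<Rightarrow> bool" where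
  "cantor_lipschitz f \<longleftrightarrow> (\<exists>C. \<forall>x y. cdist (f x) (f y) \<le> C * cdist x y)"

definition bilipschitz_homeo :: "(cantor \<Rightarrow> cantor) \<Rightarrow> bool" where
  "bilipschitz_homeo f \<longleftrightarrow> cantor_homeomorphism f \<and> cantor_lipschitz f \<and> cantor_lipschitz (inv_into UNIV f)"

text \<open>Asynchronous binary transducers (S, s0, t, o); states are taken from nat
  (any finite state set can be relabelled into nat).\<close>
definition is_transducer ::
  "nat set \<Rightarrow> nat \<Rightarrow> (nat \<Rightarrow> bool \<Rightarrow> nat) \<Rightarrow> (nat \<Rightarrow> bool \<Rightarrow> bool list) \<Rightarrow> bool" where
  "is_transducer S s0 t out \<longleftrightarrow> finite S \<and> s0 \<in> S \<and> (\<forall>s\<in>S. \<forall>b. t s b \<in> S)"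

text \<open>State sequence: s_1 = s, s_{n+1} = t(s_n, sigma_n) (indexed from 0 here).\<close>
fun run_states :: "(nat \<Rightarrow> bool \<Rightarrow> nat) \<Rightarrow> nat \<Rightarrow> cantor \<Rightarrow> nat \<Rightarrow> nat" where
  "run_states t s \<sigma> 0 = s"
| "run_states t s \<sigma> (Suc n) = t (run_states t s \<sigma> n) (\<sigma> n)"

definition out_prefix ::
  "(nat \<Rightarrow> bool \<Rightarrow> nat) \<Rightarrow> (nat \<Rightarrow> bool \<Rightarrow> bool list) \<Rightarrow> nat \<Rightarrow> cantor \<Rightarrow> nat \<Rightarrow> bool list" where
  "out_prefix t out s \<sigma> n = concat (map (\<lambda>i. out (run_states t s \<sigma> i) (\<sigma> i)) [0..<n])"

definition transducer_output ::
  "(nat \<Rightarrow> bool \<Rightarrow> nat) \<Rightarrow> (nat \<Rightarrow> bool \<Rightarrow> bool list) \<Rightarrow> nat \<Rightarrow> cantor \<Rightarrow> cantor \<Rightarrow> bool" where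
  "transducer_output t out s \<sigma> \<phi> \<longleftrightarrow>
     (\<forall>n. \<forall>k < length (out_prefix t out s \<sigma> n). out_prefix t out s \<sigma> n ! k = \<phi> k) \<and>
     (\<forall>m. \<exists>n. m \<le> length (out_prefix t out s \<sigma> n))"

definition rational_homeo :: "(cantor \<Rightarrow> cantor) \<Rightarrow> bool" where
  "rational_homeo f \<longleftrightarrow> cantor_homeomorphism f \<and>
     (\<exists>S s0 t out. is_transducer S s0 t out \<and> (\<forall>\<psi>. transducer_output t out s0 \<psi> (f \<psi>)))"

definition RBL :: "(cantor \<Rightarrow> cantor) monoid" where
  "RBL = \<lparr> carrier = {f. rational_homeo f \<and> bilipschitz_homeo f}, mult = (\<circ>), one = id \<rparr>"

text \<open>Simplicity for possibly infinite groups (HOL-Algebra's simple_group uses card,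
  which is 0 for infinite carriers).\<close>
definition simple_grp :: "('a, 'b) monoid_scheme \<Rightarrow> bool" where
  "simple_grp G \<longleftrightarrow> group G \<and> carrier G \<noteq> {\<one>\<^bsub>G\<^esub>} \<and>
     (\<forall>H. H \<lhd> G \<longrightarrow> H = carrier G \<or> H = {\<one>\<^bsub>G\<^esub>})"

definition finitely_generated :: "('a, 'b) monoid_scheme \<Rightarrow> bool" where
  "finitely_generated G \<longleftrightarrow> (\<exists>A. finite A \<and> A \<subseteq> carrier G \<and> generate G A = carrier G)"

end

theory Submission
  imports Defs "HOL-Computational_Algebra.Primes"
begin

text \<open>
  A bijection lies in the group iff it and its inverse are Lipschitz and it has finitely many local
  actions \<open>F\<close>, where \<open>f (u \<frown> x) = w \<frown> F x\<close>; composites and inverses then inherit finiteness.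

  Simplicity: if \<open>f\<close> in a normal subgroup \<open>N\<close> moves a cone off itself, then \<open>N\<close> contains the
  commutators of elements supported on that cone.  An element supported on a cone is itself a
  commutator, by an infinite swindle: infinitely many copies of it, placed on the cones \<open>1\<^sup>n0\<close>, are
  shifted by an element of Thompson's group.  As cones are permuted transitively, \<open>N\<close> contains every
  element that fixes some cone pointwise, and any element is a product of two of these.

  Infinite generation: along a cycle of states a bilipschitz transducer outputs exactly as many letters
  as it reads, so it multiplies the period of an eventually periodic sequence by at most its number of
  states.  If \<open>q\<close> is a prime larger than the number of states of each generator and of its inverse, then
  eventual periods prime to \<open>q\<close> are preserved by the whole group they generate, but not by addition modulo 2
  of the characteristic sequence of the multiples of \<open>q\<close>.
\<close>

abbreviation finv :: "('a \<Rightarrow> 'b) \<Rightarrow> 'b \<Rightarrow> 'a" where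
  "finv \<equiv> inv_into UNIV"

section \<open>Words, tails and agreement of sequences\<close>

definition scons :: "bool \<Rightarrow> cantor \<Rightarrow> cantor" (infixr "##" 65) where
  "b ## x = case_nat b x"

definition tail :: "cantor \<Rightarrow> cantor" where
  "tail x = (\<lambda>i. x (Suc i))"

primrec prepend :: "bool list \<Rightarrow> cantor \<Rightarrow> cantor" (infixr "\<frown>" 65) where
  "[] \<frown> x = x"
| "(b # u) \<frown> x = b ## u \<frown> x"

definition agree :: "nat \<Rightarrow> cantor \<Rightarrow> cantor \<Rightarrow> bool" where
  "agree n x y \<longleftrightarrow> (\<forall>i<n. x i = y i)"

lemma scons_0 [simp]: "(b ## x) 0 = b"
  and scons_Suc [simp]: "(b ## x) (Suc i) = x i"
  and tail_scons [simp]: "tail (b ## x) = x"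
  and scons_tail [simp]: "x 0 ## tail x = x"
  by (auto simp: scons_def tail_def fun_eq_iff split: nat.split)

lemma scons_eq_iff [simp]: "b ## x = c ## y \<longleftrightarrow> b = c \<and> x = y"
proof
  assume eq: "b ## x = c ## y"
  have "b = c" using fun_cong[OF eq, of 0] by simp
  moreover have "x = y" using arg_cong[OF eq, of tail] by simp
  ultimately show "b = c \<and> x = y" ..
qed simp

lemma scons_cases:
  obtains b y where "x = b ## y"
  using scons_tail[of x, symmetric] by (rule that)

lemma prepend_append [simp]: "(u @ v) \<frown> x = u \<frown> v \<frown> x"
  by (induction u) auto

lemma prepend_eq_iff [simp]: "u \<frown> x = u \<frown> y \<longleftrightarrow> x = y"
  by (induction u) auto

lemma prepend_nth: "i < length u \<Longrightarrow> (u \<frown> x) i = u ! i"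
proof (induction u arbitrary: i)
  case (Cons b u)
  then show ?case by (cases i) auto
qed simp

lemma prepend_nth_add [simp]: "(u \<frown> x) (length u + i) = x i"
  by (induction u) auto

lemma prepend_eq_cases:
  assumes "u \<frown> x = v \<frown> y"
  shows "(\<exists>z. v = u @ z \<and> x = z \<frown> y) \<or> (\<exists>c z. u = v @ c # z \<and> y = c ## z \<frown> x)"
  using assms
proof (induction u arbitrary: v)
  case (Cons b u)
  show ?case
  proof (cases v)
    case Nil
    then show ?thesis using Cons.prems by auto
  next
    case (Cons c w)
    then show ?thesis using Cons.IH[of w] Cons.prems by auto
  qed
qed auto

lemma prefix_decomposition: "x = map x [0..<n] \<frown> (\<lambda>i. x (n + i))"
proof (rule ext)
  fix i
  show "x i = (map x [0..<n] \<frown> (\<lambda>i. x (n + i))) i"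
  proof (cases "i < n")
    case True
    then show ?thesis by (simp add: prepend_nth)
  next
    case False
    then show ?thesis
      using prepend_nth_add[of "map x [0..<n]" "\<lambda>i. x (n + i)" "i - n"] by simp
  qed
qed

lemma prepend_not_id:
  assumes "u \<noteq> []"
  obtains x where "u \<frown> x \<noteq> x"
proof -
  obtain c v where "u = c # v" using assms by (cases u) auto
  then have "u \<frown> (\<lambda>_. \<not> c) \<noteq> (\<lambda>_. \<not> c)"
    by (metis prepend.simps(2) scons_0)
  then show thesis using that by blast
qed

section \<open>Common prefixes and the metric\<close>

lemma agree_0 [simp]: "agree 0 x y"
  and agree_refl [simp]: "agree n x x"
  by (auto simp: agree_def)

lemma agree_mono: "agree n x y \<Longrightarrow> m \<le> n \<Longrightarrow> agree m x y"
  by (auto simp: agree_def)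

lemma agree_scons [simp]: "agree (Suc n) (b ## x) (c ## y) \<longleftrightarrow> b = c \<and> agree n x y"
  by (auto simp: agree_def less_Suc_eq_0_disj)

lemma agree_prepend [simp]: "agree (length u + n) (u \<frown> x) (u \<frown> y) \<longleftrightarrow> agree n x y"
  by (induction u) auto

lemma agree_prepend_le: "n \<le> length u \<Longrightarrow> agree n (u \<frown> x) (u \<frown> y)"
  by (auto simp: agree_def prepend_nth)

lemma agree_imp_eq: "(\<And>n. agree n x y) \<Longrightarrow> x = y"
  by (auto simp: agree_def fun_eq_iff)

lemma not_agreeE:
  assumes "x \<noteq> y"
  obtains n where "\<not> agree n x y"
  using assms agree_imp_eq by blast

lemma agree_prefix_iff: "(\<exists>z. x = map y [0..<n] \<frown> z) \<longleftrightarrow> agree n x y"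
proof
  assume "agree n x y"
  then have "map x [0..<n] = map y [0..<n]" by (auto simp: agree_def)
  then show "\<exists>z. x = map y [0..<n] \<frown> z" by (metis prefix_decomposition)
qed (auto simp: agree_def prepend_nth)

lemma cdist_le_iff: "cdist x y \<le> (1/2) ^ n \<longleftrightarrow> agree n x y"
proof (cases "x = y")
  case True
  then show ?thesis by (simp add: cdist_def)
next
  case False
  define m where "m = (LEAST n. x n \<noteq> y n)"
  from False have ex: "\<exists>n. x n \<noteq> y n" by auto
  have m: "x m \<noteq> y m" unfolding m_def using ex by (rule LeastI_ex)
  have least: "x i = y i" if "i < m" for i
    using not_less_Least[of i "\<lambda>n. x n \<noteq> y n"] that unfolding m_def by blast
  have "cdist x y = (1/2) ^ m" using False by (simp add: cdist_def m_def)
  moreover have "agree n x y \<longleftrightarrow> n \<le> m"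
  proof
    show "agree n x y \<Longrightarrow> n \<le> m" using m unfolding agree_def by (meson not_le)
  qed (use least in \<open>auto simp: agree_def\<close>)
  ultimately show ?thesis by simp
qed

lemma cdist_nonneg: "cdist x y \<ge> 0"
  by (simp add: cdist_def)

text \<open>The Lipschitz condition with constant \<open>2 ^ K\<close>, expressed by common prefixes
  so that real numbers disappear from later arguments.\<close>

definition lip :: "(cantor \<Rightarrow> cantor) \<Rightarrow> bool" where
  "lip f \<longleftrightarrow> (\<exists>K. \<forall>n x y. agree (n + K) x y \<longrightarrow> agree n (f x) (f y))"

lemma cantor_lipschitz_iff: "cantor_lipschitz f \<longleftrightarrow> lip f"
proof
  assume "cantor_lipschitz f"
  then obtain C where C: "\<And>x y. cdist (f x) (f y) \<le> C * cdist x y"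
    unfolding cantor_lipschitz_def by blast
  obtain K :: nat where K: "C < 2 ^ K" using real_arch_pow[of 2 C] by auto
  have "agree n (f x) (f y)" if "agree (n + K) x y" for n x y
  proof -
    have "cdist (f x) (f y) \<le> C * cdist x y" by (rule C)
    also have "\<dots> \<le> 2 ^ K * cdist x y"
      using K cdist_nonneg by (intro mult_right_mono) auto
    also have "\<dots> \<le> 2 ^ K * (1/2) ^ (n + K)"
      using that by (simp add: cdist_le_iff)
    also have "\<dots> = (1/2) ^ n" by (simp add: power_add power_divide)
    finally show ?thesis by (simp add: cdist_le_iff)
  qed
  then show "lip f" unfolding lip_def by blast
next
  assume "lip f"
  then obtain K where K: "\<And>n x y. agree (n + K) x y \<Longrightarrow> agree n (f x) (f y)"
    unfolding lip_def by blast
  have "cdist (f x) (f y) \<le> 2 ^ K * cdist x y" for x y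
  proof (cases "x = y")
    case True
    then show ?thesis by (simp add: cdist_def)
  next
    case False
    then obtain N where N: "cdist x y = (1/2) ^ N" by (auto simp: cdist_def)
    then have ag: "agree N x y" using cdist_le_iff[of x y N] by simp
    show ?thesis
    proof (cases "K \<le> N")
      case True
      then have "agree (N - K) (f x) (f y)" using K[of "N - K" x y] ag by simp
      then have "cdist (f x) (f y) \<le> (1/2) ^ (N - K)" by (simp add: cdist_le_iff)
      also have "\<dots> = 2 ^ K * cdist x y"
        using True by (simp add: N power_divide power_diff)
      finally show ?thesis .
    next
      case False
      \<comment> \<open>Here \<open>cdist x y\<close> exceeds \<open>(1/2) ^ K\<close>, so the
        diameter 1 of the whole space is a good enough bound.\<close>
      have "cdist (f x) (f y) \<le> 1" using cdist_le_iff[of "f x" "f y" 0] by simp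
      also have "1 \<le> (2::real) ^ (K - N)" by simp
      also have "\<dots> = 2 ^ K * cdist x y"
        using False by (simp add: N power_divide power_diff)
      finally show ?thesis .
    qed
  qed
  then show "cantor_lipschitz f" unfolding cantor_lipschitz_def by blast
qed

lemma lip_imp_continuous:
  assumes "lip f"
  shows "cantor_continuous f"
  unfolding cantor_continuous_def
proof (intro allI impI)
  fix x and e :: real
  assume "e > 0"
  obtain K where K: "\<And>n x y. agree (n + K) x y \<Longrightarrow> agree n (f x) (f y)"
    using assms unfolding lip_def by blast
  obtain n :: nat where n: "(1/2) ^ n < e"
    using real_arch_pow_inv[OF \<open>e > 0\<close>, of "1/2"] by auto
  have "cdist (f x) (f y) < e" if "cdist x y < (1/2) ^ (n + K)" for y
  proof -
    have "agree n (f x) (f y)" using that by (intro K) (simp flip: cdist_le_iff)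
    then show ?thesis using n by (simp flip: cdist_le_iff)
  qed
  then show "\<exists>d>0. \<forall>y. cdist x y < d \<longrightarrow> cdist (f x) (f y) < e"
    by (intro exI[of _ "(1/2) ^ (n + K)"]) auto
qed

section \<open>Finite-state maps\<close>

text \<open>A transducer is represented by the finite set of maps computed from its states, which makes the
  notion independent of the labelling and meaningful for non-injective maps.\<close>

definition fs_closed :: "(cantor \<Rightarrow> cantor) set \<Rightarrow> bool" where
  "fs_closed Q \<longleftrightarrow> finite Q \<and> (\<forall>F\<in>Q. \<forall>b. \<exists>w. \<exists>F'\<in>Q. \<forall>x. F (b ## x) = w \<frown> F' x)"

definition finite_state :: "(cantor \<Rightarrow> cantor) \<Rightarrow> bool" where
  "finite_state f \<longleftrightarrow> (\<exists>Q. f \<in> Q \<and> fs_closed Q)"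

lemma fs_closed_word:
  assumes "fs_closed Q" "F \<in> Q"
  shows "\<exists>w. \<exists>F'\<in>Q. \<forall>x. F (u \<frown> x) = w \<frown> F' x"
  using assms(2)
proof (induction u arbitrary: F)
  case Nil
  then show ?case by (metis prepend.simps(1))
next
  case (Cons b u)
  obtain w F1 where 1: "F1 \<in> Q" "\<And>x. F (b ## x) = w \<frown> F1 x"
    using assms(1) Cons.prems unfolding fs_closed_def by blast
  obtain w' F' where "F' \<in> Q" "\<And>x. F1 (u \<frown> x) = w' \<frown> F' x"
    using Cons.IH[OF 1(1)] by blast
  then have "F' \<in> Q \<and> (\<forall>x. F ((b # u) \<frown> x) = (w @ w') \<frown> F' x)" using 1(2) by simp
  then show ?case by blast
qed

section \<open>Transducers compared with finite-state maps\<close>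

lemma run_states_scons:
  "run_states t s (b ## x) (Suc n) = run_states t (t s b) x n"
  by (induction n) auto

lemma out_prefix_scons:
  "out_prefix t out s (b ## x) (Suc n) = out s b @ out_prefix t out (t s b) x n"
  unfolding out_prefix_def
  by (simp add: upt_conv_Cons map_Suc_upt[symmetric] run_states_scons o_def
        del: upt_Suc run_states.simps(2))

lemma out_prefix_Suc:
  "out_prefix t out s x (Suc n) = out_prefix t out s x n @ out (run_states t s x n) (x n)"
  by (simp add: out_prefix_def)

lemma out_prefix_mono:
  assumes "i \<le> j"
  shows "\<exists>w. out_prefix t out s x j = out_prefix t out s x i @ w"
  using assms
proof (induction j rule: dec_induct)
  case (step n)
  then show ?case by (auto simp: out_prefix_Suc)
qed simp

lemma transducer_output_unique:
  assumes "transducer_output t out s x y" "transducer_output t out s x z"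
  shows "y = z"
proof (rule ext)
  fix k
  obtain n where "Suc k \<le> length (out_prefix t out s x n)"
    using assms(1) unfolding transducer_output_def by blast
  then show "y k = z k"
    using assms unfolding transducer_output_def by (metis Suc_le_lessD)
qed

lemma transducer_output_scons:
  assumes "transducer_output t out s (b ## x) y"
  shows "\<exists>z. y = out s b \<frown> z \<and> transducer_output t out (t s b) x z"
proof -
  let ?w = "out s b"
  define z where "z = (\<lambda>i. y (length ?w + i))"
  have pre: "out_prefix t out s (b ## x) n ! k = y k"
    if "k < length (out_prefix t out s (b ## x) n)" for n k
    using assms that unfolding transducer_output_def by blast
  have "map y [0..<length ?w] = ?w"
  proof (rule nth_equalityI)
    fix i assume "i < length (map y [0..<length ?w])"
    then show "map y [0..<length ?w] ! i = ?w ! i"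
      using pre[of i "Suc 0"] by (simp add: out_prefix_scons nth_append)
  qed simp
  then have y: "y = ?w \<frown> z" unfolding z_def by (metis prefix_decomposition)
  have "out_prefix t out (t s b) x n ! k = z k"
    if "k < length (out_prefix t out (t s b) x n)" for n k
    using pre[of "length ?w + k" "Suc n"] that by (simp add: out_prefix_scons z_def)
  moreover have "\<exists>n. m \<le> length (out_prefix t out (t s b) x n)" for m
  proof -
    \<comment> \<open>The extra \<open>Suc\<close> excludes \<open>n = 0\<close>, where no letter
      has been read.\<close>
    obtain n where n: "Suc (length ?w + m) \<le> length (out_prefix t out s (b ## x) n)"
      using assms unfolding transducer_output_def by blast
    then obtain n' where "n = Suc n'" by (cases n) (auto simp: out_prefix_def)
    then show ?thesis using n by (intro exI[of _ n']) (simp add: out_prefix_scons)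
  qed
  ultimately show ?thesis using y unfolding transducer_output_def by blast
qed

text \<open>Outputs are unique, so a state computes at most one map; the maps computed from states
  of \<open>S\<close> are therefore finitely many, and removing the first output word leads from one
  to another.\<close>

lemma transducer_imp_finite_state:
  assumes "is_transducer S s0 t out" "\<And>x. transducer_output t out s0 x (f x)"
  shows "finite_state f"
proof -
  define Q where "Q = {F. \<exists>s\<in>S. \<forall>x. transducer_output t out s x (F x)}"
  have "Q \<subseteq> (\<lambda>s x. THE y. transducer_output t out s x y) ` S"
  proof
    fix F assume "F \<in> Q"
    then obtain s where s: "s \<in> S" "\<And>x. transducer_output t out s x (F x)"
      unfolding Q_def by blast
    then have "F = (\<lambda>x. THE y. transducer_output t out s x y)"
      by (intro ext) (metis the_equality transducer_output_unique)
    then show "F \<in> (\<lambda>s x. THE y. transducer_output t out s x y) ` S" using s(1) by blast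
  qed
  then have "finite Q"
    using assms(1) finite_surj unfolding is_transducer_def by blast
  moreover have "\<exists>w. \<exists>F'\<in>Q. \<forall>x. F (b ## x) = w \<frown> F' x" if F: "F \<in> Q" for F b
  proof -
    obtain s where s: "s \<in> S" "\<And>x. transducer_output t out s x (F x)"
      using F unfolding Q_def by blast
    have "\<forall>x. \<exists>z. F (b ## x) = out s b \<frown> z \<and> transducer_output t out (t s b) x z"
      using transducer_output_scons[OF s(2)] by blast
    then obtain F' where
      "\<forall>x. F (b ## x) = out s b \<frown> F' x \<and> transducer_output t out (t s b) x (F' x)"
      by metis
    moreover have "t s b \<in> S" using assms(1) s(1) unfolding is_transducer_def by blast
    ultimately show ?thesis unfolding Q_def by blast
  qed
  moreover have "f \<in> Q" using assms unfolding Q_def is_transducer_def by blast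
  ultimately show ?thesis unfolding finite_state_def fs_closed_def by blast
qed

text \<open>Injectivity forces the output to be infinite: a cycle of states with empty output, read along
  a word \<open>u\<close>, would give \<open>F (u \<frown> x) = F x\<close> for all \<open>x\<close>.\<close>

lemma finite_state_imp_transducer:
  assumes "finite_state f" "inj f"
  shows "\<exists>S s0 t out. is_transducer S s0 t out \<and> (\<forall>x. transducer_output t out s0 x (f x))"
proof -
  obtain Q where fQ: "f \<in> Q" and Q: "fs_closed Q"
    using assms(1) unfolding finite_state_def by blast
  have finQ: "finite Q" using Q unfolding fs_closed_def by blast
  have "\<forall>F b. \<exists>w F'. F \<in> Q \<longrightarrow> F' \<in> Q \<and> (\<forall>x. F (b ## x) = w \<frown> F' x)"
    using Q unfolding fs_closed_def by blast
  then obtain wout d where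
    d: "\<And>F b. F \<in> Q \<Longrightarrow> d F b \<in> Q \<and> (\<forall>x. F (b ## x) = wout F b \<frown> d F b x)"
    by metis
  obtain e :: "(cantor \<Rightarrow> cantor) \<Rightarrow> nat" where e: "inj_on e Q"
    using finite_imp_inj_to_nat_seg[OF finQ] by blast
  define dec where "dec = inv_into Q e"
  have dec: "dec (e F) = F" if "F \<in> Q" for F
    using e that by (simp add: dec_def)
  define t where "t = (\<lambda>s b. e (d (dec s) b))"
  define out where "out = (\<lambda>s b. wout (dec s) b)"
  define S where "S = e ` Q"
  have tr: "is_transducer S (e f) t out"
    using fQ finQ dec d unfolding is_transducer_def S_def t_def by auto
  have "transducer_output t out (e f) x (f x)" for x
  proof -
    let ?st = "run_states t (e f) x" and ?o = "out_prefix t out (e f) x"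
    have st: "?st n \<in> S" for n
      using tr by (induction n) (auto simp: is_transducer_def)
    have run: "f (map x [0..<n] \<frown> y) = ?o n \<frown> dec (?st n) y" for n y
    proof (induction n arbitrary: y)
      case 0
      then show ?case using dec fQ by (simp add: out_prefix_def)
    next
      case (Suc n)
      have F: "dec (?st n) \<in> Q" using st[of n] dec unfolding S_def by auto
      have "dec (?st n) (x n ## y) = out (?st n) (x n) \<frown> dec (?st (Suc n)) y"
        using d[OF F] dec by (simp add: out_def t_def)
      then show ?case using Suc[of "x n ## y"] by (simp add: out_prefix_Suc)
    qed
    have "?o n ! k = f x k" if "k < length (?o n)" for n k
      using run[of n "\<lambda>i. x (n + i)"] that prepend_nth prefix_decomposition by metis
    moreover have "\<exists>n. m \<le> length (?o n)" for m
    proof (rule ccontr)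
      assume "\<nexists>n. m \<le> length (?o n)"
      \<comment> \<open>Bounded output leaves finitely many pairs of state and output length, so two
        times \<open>i < j\<close> share a pair; as outputs extend one another, the outputs
        themselves coincide.\<close>
      then have "(\<lambda>n. (?st n, length (?o n))) ` UNIV \<subseteq> S \<times> {..m}"
        using st by (auto simp: not_le less_imp_le)
      moreover have "finite (S \<times> {..m})" using finQ by (simp add: S_def)
      ultimately have "\<not> inj (\<lambda>n. (?st n, length (?o n)))"
        using finite_subset finite_imageD infinite_UNIV_nat by metis
      then obtain i j where ij: "i < j" "?st i = ?st j" "length (?o i) = length (?o j)"
        unfolding inj_def by (metis (no_types, lifting) Pair_inject linorder_neqE_nat)
      then have oeq: "?o i = ?o j"
        using out_prefix_mono[of i j t out "e f" x] by auto
      define u where "u = map x [i..<j]"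
      have split: "map x [0..<j] = map x [0..<i] @ u"
        using ij(1) upt_add_eq_append[of 0 i "j - i"] by (simp add: u_def)
      have "u \<noteq> []" using ij(1) by (simp add: u_def)
      then obtain y where y: "u \<frown> y \<noteq> y" by (rule prepend_not_id)
      have "f (map x [0..<i] \<frown> u \<frown> y) = f (map x [0..<i] \<frown> y)"
        using run[of i y] run[of j y] ij(2) oeq by (simp add: split)
      then show False using assms(2) y by (simp add: inj_eq)
    qed
    ultimately show ?thesis unfolding transducer_output_def by blast
  qed
  then show ?thesis using tr by blast
qed

section \<open>Closure of finite-state and Lipschitz maps under composition and case
  distinction\<close>

lemma finite_state_id: "finite_state id"
proof -
  have "id (b ## x) = [b] \<frown> id x" for b x by simp
  then have "fs_closed {id}" unfolding fs_closed_def by blast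
  then show ?thesis unfolding finite_state_def by blast
qed

text \<open>The states are pairs: while \<open>F\<close> reads one letter, \<open>G\<close> reads
  the whole word that \<open>F\<close> outputs.\<close>

lemma finite_state_comp:
  assumes "finite_state f" "finite_state g"
  shows "finite_state (g \<circ> f)"
proof -
  obtain P Q where P: "f \<in> P" "fs_closed P" and Q: "g \<in> Q" "fs_closed Q"
    using assms unfolding finite_state_def by blast
  define R where "R = (\<lambda>(G, F). G \<circ> F) ` (Q \<times> P)"
  have "\<exists>w. \<exists>H'\<in>R. \<forall>x. H (b ## x) = w \<frown> H' x" if "H \<in> R" for H b
  proof -
    obtain G F where H: "G \<in> Q" "F \<in> P" "H = G \<circ> F"
      using \<open>H \<in> R\<close> unfolding R_def by auto
    obtain u F' where F': "F' \<in> P" "\<And>x. F (b ## x) = u \<frown> F' x"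
      using P(2) H(2) unfolding fs_closed_def by blast
    obtain w G' where G': "G' \<in> Q" "\<And>x. G (u \<frown> x) = w \<frown> G' x"
      using fs_closed_word[OF Q(2) H(1)] by blast
    have "G' \<circ> F' \<in> R" using F'(1) G'(1) unfolding R_def by blast
    moreover have "\<forall>x. H (b ## x) = w \<frown> (G' \<circ> F') x" using F'(2) G'(2) H(3) by simp
    ultimately show ?thesis by blast
  qed
  moreover have "finite R" using P(2) Q(2) unfolding R_def fs_closed_def by blast
  moreover have "g \<circ> f \<in> R" using P(1) Q(1) unfolding R_def by blast
  ultimately show ?thesis unfolding finite_state_def fs_closed_def by blast
qed

text \<open>A one-letter buffer: the held letter is emitted and the letter just read is held
  instead.\<close>

lemma finite_state_scons: "finite_state (scons b)"
proof -
  have "\<exists>w. \<exists>F'\<in>range scons. \<forall>x. scons b (c ## x) = w \<frown> F' x" for b c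
    by (intro exI[of _ "[b]"] bexI[of _ "scons c"]) auto
  then have "fs_closed (range scons)" unfolding fs_closed_def by auto
  then show ?thesis unfolding finite_state_def by blast
qed

text \<open>A new start state reads one letter silently and hands over to the states for that
  half.\<close>

lemma finite_state_split:
  assumes "\<And>b. finite_state (\<lambda>x. f (b ## x))"
  shows "finite_state f"
proof -
  have "\<forall>b. \<exists>Q. (\<lambda>x. f (b ## x)) \<in> Q \<and> fs_closed Q"
    using assms unfolding finite_state_def by blast
  then obtain Q where Q: "\<And>b. (\<lambda>x. f (b ## x)) \<in> Q b" "\<And>b. fs_closed (Q b)"
    by metis
  let ?R = "insert f (\<Union>b. Q b)"
  have "\<exists>w. \<exists>F'\<in>?R. \<forall>x. F (b ## x) = w \<frown> F' x" if F: "F \<in> ?R" for F b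
  proof (cases "F = f")
    case True
    then show ?thesis
      using Q(1)[of b] by (intro exI[of _ "[]"] bexI[of _ "\<lambda>x. f (b ## x)"]) auto
  next
    case False
    then obtain c where "F \<in> Q c" using F by blast
    then obtain w F' where "F' \<in> Q c" "\<forall>x. F (b ## x) = w \<frown> F' x"
      using Q(2)[of c] unfolding fs_closed_def by blast
    then show ?thesis by blast
  qed
  moreover have "finite ?R" using Q(2) unfolding fs_closed_def by simp
  ultimately have "fs_closed ?R" unfolding fs_closed_def by (intro conjI ballI allI)
  then show ?thesis unfolding finite_state_def by (intro exI[of _ ?R]) simp
qed

lemma lip_id: "lip id"
  unfolding lip_def by (metis add_0_right id_apply)

lemma lip_comp:
  assumes "lip f" "lip g"
  shows "lip (g \<circ> f)"
proof -
  obtain K L where K: "\<And>n x y. agree (n + K) x y \<Longrightarrow> agree n (f x) (f y)"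
    and L: "\<And>n x y. agree (n + L) x y \<Longrightarrow> agree n (g x) (g y)"
    using assms unfolding lip_def by blast
  have "agree n ((g \<circ> f) x) ((g \<circ> f) y)" if "agree (n + (L + K)) x y" for n x y
    using K[of "n + L" x y] L[of n "f x" "f y"] that by (simp add: add.assoc)
  then show ?thesis unfolding lip_def by blast
qed

lemma lip_scons: "lip (scons b)"
proof -
  have "agree n (b ## x) (b ## y)" if "agree (n + 0) x y" for n x y
    using that by (cases n) (auto intro: agree_mono)
  then show ?thesis unfolding lip_def by blast
qed

lemma lip_split:
  assumes "\<And>b. lip (\<lambda>x. f (b ## x))"
  shows "lip f"
proof -
  have "\<forall>b. \<exists>K. \<forall>n x y. agree (n + K) x y \<longrightarrow> agree n (f (b ## x)) (f (b ## y))"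
    using assms unfolding lip_def by blast
  then obtain K where
    K: "\<And>b n x y. agree (n + K b) x y \<Longrightarrow> agree n (f (b ## x)) (f (b ## y))"
    by metis
  \<comment> \<open>The \<open>Suc\<close> forces equal first letters even for \<open>n = 0\<close>;
    the sum bounds both constants.\<close>
  have "agree n (f x) (f y)" if a: "agree (n + Suc (K True + K False)) x y" for n x y
  proof -
    obtain b x' where x: "x = b ## x'" by (rule scons_cases)
    obtain c y' where y: "y = c ## y'" by (rule scons_cases)
    have "b = c" and "agree (n + (K True + K False)) x' y'" using a by (auto simp: x y)
    moreover have "n + K b \<le> n + (K True + K False)" by (cases b) auto
    ultimately have "agree n (f (b ## x')) (f (b ## y'))" using K agree_mono by blast
    then show ?thesis using \<open>b = c\<close> by (simp add: x y)
  qed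
  then show ?thesis unfolding lip_def by blast
qed

text \<open>Bijectivity is left out so that group elements can be assembled from maps such as
  \<open>scons b\<close> and \<open>tail\<close>.\<close>

definition fsl :: "(cantor \<Rightarrow> cantor) \<Rightarrow> bool" where
  "fsl f \<longleftrightarrow> finite_state f \<and> lip f"

lemma fsl_id: "fsl id"
  by (simp add: fsl_def finite_state_id lip_id)

lemma fsl_comp: "fsl f \<Longrightarrow> fsl g \<Longrightarrow> fsl (g \<circ> f)"
  by (simp add: fsl_def finite_state_comp lip_comp)

lemma fsl_scons: "fsl (scons b)"
  by (simp add: fsl_def finite_state_scons lip_scons)

lemma fsl_scons_comp: "fsl f \<Longrightarrow> fsl (\<lambda>x. b ## f x)"
  using fsl_comp[OF _ fsl_scons] by (simp add: comp_def)

lemma fsl_comp_scons: "fsl f \<Longrightarrow> fsl (\<lambda>x. f (b ## x))"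
  using fsl_comp[OF fsl_scons] by (simp add: comp_def)

lemma fsl_split:
  assumes "\<And>b. fsl (\<lambda>x. f (b ## x))"
  shows "fsl f"
  using assms finite_state_split lip_split unfolding fsl_def by blast

lemma fsl_tail: "fsl tail"
  by (rule fsl_split) (simp add: fsl_id[unfolded id_def])

lemma fsl_piecewise:
  assumes "\<And>u. length u = m \<Longrightarrow> \<exists>h. fsl h \<and> (\<forall>x. f (u \<frown> x) = h (u \<frown> x))"
  shows "fsl f"
  using assms
proof (induction m arbitrary: f)
  case 0
  then obtain h where "fsl h" "\<forall>x. f x = h x" by (metis list.size(3) prepend.simps(1))
  then show ?case by (metis ext)
next
  case (Suc m)
  have "fsl (\<lambda>x. f (b ## x))" for b
  proof (rule Suc.IH)
    fix u :: "bool list" assume "length u = m"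
    then obtain h where "fsl h" "\<forall>x. f (b ## u \<frown> x) = h (b ## u \<frown> x)"
      using Suc.prems[of "b # u"] by auto
    then show "\<exists>h. fsl h \<and> (\<forall>x. f (b ## u \<frown> x) = h (u \<frown> x))"
      using fsl_comp_scons[of h b] by blast
  qed
  then show ?case by (rule fsl_split)
qed

text \<open>The states of the inverse are the maps \<open>y \<mapsto> F\<inverse> (v \<frown> y)\<close>.  Pulling out the
  longest prefix \<open>u\<close> common to all values of such a map replaces \<open>F\<close> by its local action at \<open>u\<close>
  and leaves a word \<open>v\<close> so short that \<open>F\<inverse> (v \<frown> y)\<close> does not yet determine its first letter;
  the Lipschitz condition on the inverse bounds the length of such words.\<close>

lemma finite_state_inv:
  assumes "finite_state f" "bij f" "lip (finv f)"
  shows "finite_state (finv f)"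
proof -
  obtain Q where Q: "f \<in> Q" "fs_closed Q" using assms(1) unfolding finite_state_def by blast
  have injf: "inj f" using assms(2) by (rule bij_is_inj)
  \<comment> \<open>Restricting to the local actions of \<open>f\<close> itself lets them inherit
    injectivity from \<open>f\<close>.\<close>
  define R where "R = {F \<in> Q. \<exists>u w. \<forall>x. f (u \<frown> x) = w \<frown> F x}"
  have finR: "finite R" using Q(2) unfolding R_def fs_closed_def by simp
  have fR: "f \<in> R" using Q(1) unfolding R_def by (auto intro!: exI[of _ "[]"])
  have step: "\<exists>w. \<exists>F'\<in>R. \<forall>x. F (u \<frown> x) = w \<frown> F' x" if F: "F \<in> R" for F u
  proof -
    obtain u0 w0 where 0: "F \<in> Q" "\<And>x. f (u0 \<frown> x) = w0 \<frown> F x"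
      using F unfolding R_def by blast
    obtain w F' where 1: "F' \<in> Q" "\<And>x. F (u \<frown> x) = w \<frown> F' x"
      using fs_closed_word[OF Q(2) 0(1)] by blast
    have "\<forall>x. f ((u0 @ u) \<frown> x) = (w0 @ w) \<frown> F' x" using 0(2) 1(2) by simp
    then have "F' \<in> R" using 1(1) unfolding R_def by blast
    then show ?thesis using 1(2) by blast
  qed
  have injR: "inj F" if F: "F \<in> R" for F
  proof (rule injI)
    fix x y assume eq: "F x = F y"
    obtain u w where "\<And>x. f (u \<frown> x) = w \<frown> F x" using F unfolding R_def by blast
    then have "f (u \<frown> x) = f (u \<frown> y)" using eq by simp
    then show "x = y" using injf by (simp add: inj_eq)
  qed
  obtain K where K: "\<And>n x y. agree (n + K) x y \<Longrightarrow> agree n (finv f x) (finv f y)"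
    using assms(3) unfolding lip_def by blast
  \<comment> \<open>The first letter of \<open>x\<close> is the letter of
    \<open>u \<frown> x\<close> at position \<open>length u\<close>; the Lipschitz inverse
    determines it from boundedly many letters of \<open>F x\<close>.\<close>
  have "\<exists>C. \<forall>x y. agree C (F x) (F y) \<longrightarrow> x 0 = y 0" if F: "F \<in> R" for F
  proof -
    obtain u w where uw: "\<And>x. f (u \<frown> x) = w \<frown> F x" using F unfolding R_def by blast
    have "x 0 = y 0" if a: "agree (Suc (length u) + K) (F x) (F y)" for x y
    proof -
      have "agree (length w + (Suc (length u) + K)) (w \<frown> F x) (w \<frown> F y)" 
        using a by (simp only: agree_prepend)
      then have "agree (Suc (length u) + K) (f (u \<frown> x)) (f (u \<frown> y))"
        unfolding uw by (rule agree_mono) simp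
      then have "agree (length u + 1) (u \<frown> x) (u \<frown> y)"
        using K[of "Suc (length u)" "f (u \<frown> x)" "f (u \<frown> y)"] injf by simp
      then show ?thesis unfolding agree_prepend by (simp add: agree_def)
    qed
    then show ?thesis by blast
  qed
  then have "\<forall>F\<in>R. \<exists>C. \<forall>x y. agree C (F x) (F y) \<longrightarrow> x 0 = y 0" by blast
  then obtain c where c: "\<And>F x y. F \<in> R \<Longrightarrow> agree (c F) (F x) (F y) \<Longrightarrow> x 0 = y 0"
    by metis
  define C where "C = (\<Sum>F\<in>R. c F)"
  have C: "x 0 = y 0" if "F \<in> R" "agree C (F x) (F y)" for F x y
    using that c[of F x y] member_le_sum[of F R c] finR agree_mono unfolding C_def by blast
  \<comment> \<open>A local action need not be surjective; the range condition makes
    \<open>finv F\<close> a true inverse on the cone of \<open>v\<close>.\<close>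
  define T where "T = {(F, v). F \<in> R \<and> length v \<le> C \<and> (\<forall>y. v \<frown> y \<in> range F)}"
  define Q' where "Q' = (\<lambda>(F, v) y. finv F (v \<frown> y)) ` T"
  have "T \<subseteq> R \<times> {v. set v \<subseteq> UNIV \<and> length v \<le> C}" unfolding T_def by auto
  then have "finite T"
    by (rule finite_subset) (use finite_lists_length_le[of "UNIV :: bool set" C] finR in simp)
  then have "finite Q'" unfolding Q'_def by simp
  have "(f, []) \<in> T" using fR assms(2) by (simp add: T_def bij_is_surj)
  then have inQ': "finv f \<in> Q'" unfolding Q'_def by (auto intro!: image_eqI[of _ _ "(f, [])"])
  have pull_out: "\<exists>u. \<exists>H\<in>Q'. \<forall>y. finv F (v \<frown> y) = u \<frown> H y"
    if F: "F \<in> R" and v: "\<And>y. v \<frown> y \<in> range F" for F v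
  proof -
    define g where "g y = finv F (v \<frown> y)" for y
    have Fg: "F (g y) = v \<frown> y" for y using v by (simp add: g_def f_inv_into_f)
    \<comment> \<open>\<open>P n\<close> says that all values of \<open>g\<close> share a prefix of
      length \<open>n\<close>; two distinct values \<open>g a\<close>, \<open>g b\<close> bound such
      \<open>n\<close>, so a greatest one exists.\<close>
    define P where "P n \<longleftrightarrow> (\<exists>u. length u = n \<and> (\<forall>y. \<exists>x. g y = u \<frown> x))" for n
    have "P 0" unfolding P_def by auto
    define a b :: cantor where "a = (\<lambda>_. True)" and "b = (\<lambda>_. False)"
    have "a \<noteq> b" unfolding a_def b_def by (simp add: fun_eq_iff)
    then have "g a \<noteq> g b" using Fg by (metis prepend_eq_iff)
    then obtain N where N: "\<not> agree N (g a) (g b)" by (rule not_agreeE)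
    have "n \<le> N" if "P n" for n
    proof (rule ccontr)
      assume "\<not> n \<le> N"
      obtain u x y where "length u = n" "g a = u \<frown> x" "g b = u \<frown> y"
        using \<open>P n\<close> unfolding P_def by metis
      then show False using N agree_prepend_le[of N u x y] \<open>\<not> n \<le> N\<close> by simp
    qed
    then obtain n where n: "P n" "\<And>m. P m \<Longrightarrow> m \<le> n"
      using GreatestI_nat[of P 0 N] Greatest_le_nat[of P _ N] \<open>P 0\<close> by metis
    obtain u where u: "length u = n" "\<forall>y. \<exists>x. g y = u \<frown> x" using n(1) unfolding P_def by blast
    then obtain h where h: "\<And>y. g y = u \<frown> h y" by metis
    obtain w F' where F': "F' \<in> R" "\<And>x. F (u \<frown> x) = w \<frown> F' x" using step[OF F] by blast
    have eq: "v \<frown> y = w \<frown> F' (h y)" for y using Fg[of y] F'(2) h by simp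
    \<comment> \<open>Were \<open>w\<close> strictly longer than \<open>v\<close>, every
      \<open>y\<close> would begin with the letter \<open>c\<close> following \<open>v\<close> in
      \<open>w\<close>, which fails for the constant sequence \<open>\<not> c\<close>.\<close>
    obtain v' where v': "v = w @ v'"
    proof (rule ccontr)
      assume "\<not> thesis"
      then have "\<nexists>z. v = w @ z" using that by blast
      then obtain c z where cz: "w = v @ c # z"
        using prepend_eq_cases[of w "F' (h a)" v a] eq[of a] by auto
      have "(\<lambda>_. \<not> c) = c ## z \<frown> F' (h (\<lambda>_. \<not> c))"
        using eq[of "\<lambda>_. \<not> c"] by (simp add: cz)
      from fun_cong[OF this, of 0] show False by simp
    qed
    have Fh: "F' (h y) = v' \<frown> y" for y using eq[of y] by (simp add: v')
    have invh: "finv F' (v' \<frown> y) = h y" for y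
      using injR[OF F'(1)] by (metis Fh inv_f_f)
    \<comment> \<open>Otherwise all \<open>h y\<close> have the same first letter, and appending it
      to \<open>u\<close> contradicts the maximality of \<open>n\<close>.\<close>
    have "length v' \<le> C"
    proof (rule ccontr)
      assume "\<not> length v' \<le> C"
      then have "agree C (F' (h y)) (F' (h a))" for y
        unfolding Fh by (intro agree_prepend_le) simp
      then have "h y 0 = h a 0" for y using C[OF F'(1)] by blast
      then have "g y = (u @ [h a 0]) \<frown> tail (h y)" for y
        using h[of y] by (simp flip: \<open>h y 0 = h a 0\<close>)
      then have "P (Suc n)" unfolding P_def using u(1) by (metis length_append_singleton)
      then show False using n(2) by fastforce
    qed
    moreover have "v' \<frown> y \<in> range F'" for y using rangeI[of F' "h y"] by (simp add: Fh)
    ultimately have "(F', v') \<in> T" unfolding T_def using F'(1) by simp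
    then have "(\<lambda>y. finv F' (v' \<frown> y)) \<in> Q'" unfolding Q'_def by force
    moreover have "\<forall>y. finv F (v \<frown> y) = u \<frown> finv F' (v' \<frown> y)" using h invh by (simp add: g_def)
    ultimately show ?thesis
      by (intro exI[of _ u] bexI[of _ "\<lambda>y. finv F' (v' \<frown> y)"])
  qed
  have "\<exists>u. \<exists>H'\<in>Q'. \<forall>y. H (b ## y) = u \<frown> H' y" if H: "H \<in> Q'" for H b
  proof -
    obtain F v where Fv: "F \<in> R" "\<forall>y. v \<frown> y \<in> range F" "H = (\<lambda>y. finv F (v \<frown> y))"
      using H unfolding Q'_def T_def by auto
    have "\<And>y. (v @ [b]) \<frown> y \<in> range F" using Fv(2) by simp
    from pull_out[OF Fv(1) this] show ?thesis by (simp add: Fv(3))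
  qed
  then have "fs_closed Q'" using \<open>finite Q'\<close> unfolding fs_closed_def by blast
  then show ?thesis using inQ' unfolding finite_state_def by blast
qed

section \<open>The group\<close>

text \<open>\<open>finite_state_inv\<close> makes the condition symmetric in \<open>f\<close> and
  \<open>finv f\<close>; injectivity turns finite-state maps back into transducers, and continuity
  follows from the Lipschitz condition.\<close>

lemma RBL_iff: "f \<in> carrier RBL \<longleftrightarrow> bij f \<and> fsl f \<and> fsl (finv f)"
proof
  assume "f \<in> carrier RBL"
  then have rat: "rational_homeo f" and bil: "bilipschitz_homeo f" by (auto simp: RBL_def)
  have "bij f" "lip f" "lip (finv f)"
    using bil by (auto simp: bilipschitz_homeo_def cantor_homeomorphism_def cantor_lipschitz_iff)
  moreover have "finite_state f"
    using rat transducer_imp_finite_state unfolding rational_homeo_def by blast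
  ultimately show "bij f \<and> fsl f \<and> fsl (finv f)" by (simp add: fsl_def finite_state_inv)
next
  assume a: "bij f \<and> fsl f \<and> fsl (finv f)"
  then have "cantor_homeomorphism f"
    by (simp add: fsl_def cantor_homeomorphism_def lip_imp_continuous)
  then show "f \<in> carrier RBL"
    using a finite_state_imp_transducer
    by (simp add: RBL_def fsl_def rational_homeo_def bilipschitz_homeo_def cantor_lipschitz_iff bij_is_inj)
qed

lemma RBL_I:
  assumes "fsl f" "fsl g" "\<And>x. f (g x) = x" "\<And>x. g (f x) = x"
  shows "f \<in> carrier RBL" and "finv f = g"
proof -
  have "bij f" using assms(3,4) by (metis bijI')
  moreover show "finv f = g" using assms(3,4) by (metis ext inv_equality)
  ultimately show "f \<in> carrier RBL" using assms(1,2) by (simp add: RBL_iff)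
qed

lemma RBL_inv_apply [simp]:
  assumes "f \<in> carrier RBL"
  shows "f (finv f x) = x" and "finv f (f x) = x"
  using assms by (auto simp: RBL_iff bij_is_inj bij_is_surj surj_f_inv_f)

lemma RBL_inv_closed: "f \<in> carrier RBL \<Longrightarrow> finv f \<in> carrier RBL"
  by (simp add: RBL_iff bij_imp_bij_inv inv_inv_eq)

lemma RBL_comp_closed: "f \<in> carrier RBL \<Longrightarrow> g \<in> carrier RBL \<Longrightarrow> f \<circ> g \<in> carrier RBL"
  by (simp add: RBL_iff bij_comp o_inv_distrib fsl_comp)

lemma mult_RBL [simp]: "f \<otimes>\<^bsub>RBL\<^esub> g = f \<circ> g"
  and one_RBL [simp]: "\<one>\<^bsub>RBL\<^esub> = id"
  by (simp_all add: RBL_def)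

lemma id_RBL: "id \<in> carrier RBL"
  by (rule RBL_I[of _ id]) (simp_all add: fsl_id)

lemma group_RBL: "group RBL"
proof (rule groupI)
  fix f assume f: "f \<in> carrier RBL"
  then have "finv f \<circ> f = id" by auto
  then show "\<exists>g\<in>carrier RBL. g \<otimes>\<^bsub>RBL\<^esub> f = \<one>\<^bsub>RBL\<^esub>" using f RBL_inv_closed by auto
qed (auto simp: RBL_comp_closed id_RBL comp_assoc)

lemma inv_RBL [simp]:
  assumes "f \<in> carrier RBL"
  shows "inv\<^bsub>RBL\<^esub> f = finv f"
  using assms by (intro group.inv_equality[OF group_RBL]) (auto simp: RBL_inv_closed)

section \<open>Elements supported on cones\<close>

definition on_cone :: "bool \<Rightarrow> (cantor \<Rightarrow> cantor) \<Rightarrow> cantor \<Rightarrow> cantor" where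
  "on_cone b f x = (if x 0 = b then b ## f (tail x) else x)"

primrec on_word :: "bool list \<Rightarrow> (cantor \<Rightarrow> cantor) \<Rightarrow> cantor \<Rightarrow> cantor" where
  "on_word [] f = f"
| "on_word (b # u) f = on_cone b (on_word u f)"

lemma on_cone_scons [simp]: "on_cone b f (c ## x) = (if c = b then b ## f x else c ## x)"
  by (simp add: on_cone_def)

lemma fsl_on_cone:
  assumes "fsl f"
  shows "fsl (on_cone b f)"
proof (rule fsl_split)
  fix c
  show "fsl (\<lambda>x. on_cone b f (c ## x))"
    by (cases "c = b") (simp_all add: assms fsl_scons_comp fsl_scons)
qed

lemma
  assumes "f \<in> carrier RBL"
  shows on_cone_RBL: "on_cone b f \<in> carrier RBL"
    and finv_on_cone: "finv (on_cone b f) = on_cone b (finv f)"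
proof -
  have fsl: "fsl (on_cone b f)" "fsl (on_cone b (finv f))"
    using assms by (simp_all add: RBL_iff fsl_on_cone)
  have inv: "on_cone b f (on_cone b (finv f) x) = x" "on_cone b (finv f) (on_cone b f x) = x" for x
    using assms by (cases x rule: scons_cases; simp)+
  show "on_cone b f \<in> carrier RBL" "finv (on_cone b f) = on_cone b (finv f)"
    using RBL_I[OF fsl inv] .
qed

lemma on_word_RBL: "f \<in> carrier RBL \<Longrightarrow> on_word u f \<in> carrier RBL"
  by (induction u) (simp_all add: on_cone_RBL)

lemma finv_on_word: "f \<in> carrier RBL \<Longrightarrow> finv (on_word u f) = on_word u (finv f)"
  by (induction u) (simp_all add: finv_on_cone on_word_RBL)

lemma on_word_append: "on_word (u @ v) f = on_word u (on_word v f)"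
  by (induction u) simp_all

lemma on_word_apply [simp]: "on_word u f (u \<frown> x) = u \<frown> f x"
  by (induction u) simp_all

lemma on_word_outside: "x \<notin> range (prepend u) \<Longrightarrow> on_word u f x = x"
proof (induction u arbitrary: x)
  case (Cons b u)
  obtain c y where x: "x = c ## y" by (rule scons_cases)
  then have "c = b \<Longrightarrow> y \<notin> range (prepend u)" using Cons.prems by auto
  then show ?case using Cons.IH by (simp add: x)
qed auto

text \<open>\<open>s\<close> maps the cone of \<open>w\<close> onto that of \<open>v\<close> by
  replacing the prefix, so conjugation carries one copy of \<open>h\<close> to the other.\<close>

lemma conj_on_word:
  assumes s: "s \<in> carrier RBL" and sw: "\<And>x. s (w \<frown> x) = v \<frown> x"
  shows "s \<circ> on_word w h \<circ> finv s = on_word v h"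
proof (rule ext)
  fix x
  show "(s \<circ> on_word w h \<circ> finv s) x = on_word v h x"
  proof (cases "x \<in> range (prepend v)")
    case True
    then obtain y where x: "x = v \<frown> y" by blast
    have "finv s x = w \<frown> y" using s by (simp add: x flip: sw)
    then show ?thesis by (simp add: x sw)
  next
    case False
    have "finv s x \<notin> range (prepend w)"
    proof
      assume "finv s x \<in> range (prepend w)"
      then obtain y where "finv s x = w \<frown> y" by blast
      then have "x = v \<frown> y" using s sw by (metis RBL_inv_apply(1))
      then show False using False by blast
    qed
    then show ?thesis using s False by (simp add: on_word_outside)
  qed
qed

text \<open>A bijection fixing one half pointwise preserves the other half; \<open>h\<close> is its
  action there with the first letter deleted.\<close>

lemma fixes_cone_imp_on_cone:
  assumes k: "k \<in> carrier RBL" and fixed: "\<And>x. k (True ## x) = True ## x"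
  shows "\<exists>h\<in>carrier RBL. k = on_cone False h"
proof -
  have fsl: "fsl (\<lambda>x. tail (f (False ## x)))" if "fsl f" for f
    using fsl_comp[OF fsl_comp_scons[OF that] fsl_tail] by (simp add: comp_def)
  have fixed': "finv k (True ## x) = True ## x" for x
    using k fixed by (metis RBL_inv_apply(2))
  have off: "\<exists>y. f (False ## x) = False ## y"
    if "f \<in> carrier RBL" "\<And>x. f (True ## x) = True ## x" for f x
  proof -
    obtain c y where cy: "f (False ## x) = c ## y" by (rule scons_cases)
    have "inj f" using that(1) by (simp add: RBL_iff bij_is_inj)
    moreover have "False ## x \<noteq> True ## y" by simp
    ultimately have "f (False ## x) \<noteq> True ## y" using that(2)[of y] by (metis injD)
    then have "\<not> c" using cy by auto
    then show ?thesis using cy by auto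
  qed
  define h where "h = (\<lambda>x. tail (k (False ## x)))"
  define h' where "h' = (\<lambda>x. tail (finv k (False ## x)))"
  have kh: "k (False ## x) = False ## h x" for x
    using off[OF k fixed, of x] by (auto simp: h_def)
  have kh': "finv k (False ## x) = False ## h' x" for x
    using off[OF RBL_inv_closed[OF k] fixed', of x] by (auto simp: h'_def)
  have "False ## h (h' x) = False ## x" for x using k by (simp flip: kh kh')
  moreover have "False ## h' (h x) = False ## x" for x using k by (simp flip: kh kh')
  moreover have "fsl h" "fsl h'"
    unfolding h_def h'_def using k by (auto intro!: fsl simp: RBL_iff)
  ultimately have "h \<in> carrier RBL" using RBL_I(1)[of h h'] by simp
  moreover have "k x = on_cone False h x" for x
    by (cases x rule: scons_cases) (use kh fixed in auto)
  ultimately show ?thesis by blast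
qed

section \<open>Transitivity on cones by elements of Thompson's group V\<close>

definition flip :: "cantor \<Rightarrow> cantor" where
  "flip x = (\<not> x 0) ## tail x"

lemma flip_scons [simp]: "flip (b ## x) = (\<not> b) ## x"
  by (simp add: flip_def)

lemma flip_RBL: "flip \<in> carrier RBL"
proof (rule RBL_I)
  show "fsl flip" by (rule fsl_split) (simp add: fsl_scons)
  then show "fsl flip" .
qed (simp_all add: flip_def)

text \<open>The generator \<open>x\<^sub>0\<close> of Thompson's group \<open>F\<close>: \<open>0 \<mapsto> 00\<close>, \<open>10 \<mapsto> 01\<close>, \<open>11 \<mapsto> 1\<close>.\<close>

definition thompson_x0 :: "cantor \<Rightarrow> cantor" where
  "thompson_x0 x = (if x 0 then if tail x 0 then tail x else False ## True ## tail (tail x)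
    else False ## x)"

definition thompson_x0_inv :: "cantor \<Rightarrow> cantor" where
  "thompson_x0_inv x = (if x 0 then True ## x
    else if tail x 0 then True ## False ## tail (tail x) else tail x)"

lemma thompson_x0_simps [simp]:
  "thompson_x0 (False ## x) = False ## False ## x"
  "thompson_x0 (True ## False ## x) = False ## True ## x"
  "thompson_x0 (True ## True ## x) = True ## x"
  by (simp_all add: thompson_x0_def)

lemma thompson_x0_inv_simps [simp]:
  "thompson_x0_inv (True ## x) = True ## True ## x"
  "thompson_x0_inv (False ## True ## x) = True ## False ## x"
  "thompson_x0_inv (False ## False ## x) = False ## x"
  by (simp_all add: thompson_x0_inv_def)

lemma
  shows thompson_x0_RBL: "thompson_x0 \<in> carrier RBL"
    and finv_thompson_x0: "finv thompson_x0 = thompson_x0_inv"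
proof -
  have "fsl (\<lambda>x. thompson_x0 (b ## c ## x))" for b c
    by (cases b; cases c) (auto intro!: fsl_scons_comp fsl_scons)
  then have 1: "fsl thompson_x0" by - (rule fsl_split, rule fsl_split)
  have "fsl (\<lambda>x. thompson_x0_inv (b ## c ## x))" for b c
    by (cases b; cases c) (auto intro!: fsl_scons_comp fsl_scons)
  then have 2: "fsl thompson_x0_inv" by - (rule fsl_split, rule fsl_split)
  have split: "\<exists>b c y. x = b ## c ## y" for x
    using scons_tail[of x] scons_tail[of "tail x"] by metis
  have 3: "thompson_x0 (thompson_x0_inv x) = x" for x
  proof -
    obtain b c y where "x = b ## c ## y" using split by blast
    then show ?thesis by (cases b; cases c) auto
  qed
  have 4: "thompson_x0_inv (thompson_x0 x) = x" for x
  proof -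
    obtain b c y where "x = b ## c ## y" using split by blast
    then show ?thesis by (cases b; cases c) auto
  qed
  show "thompson_x0 \<in> carrier RBL" "finv thompson_x0 = thompson_x0_inv"
    using RBL_I[OF 1 2 3 4] .
qed

text \<open>Induction: \<open>on_cone b t\<close> turns the prefix \<open>b # v\<close> into
  \<open>[b, True]\<close>, \<open>s\<close> turns this into \<open>[True, True]\<close>, and
  \<open>thompson_x0\<close> contracts it to \<open>[True]\<close>.\<close>

lemma cone_transitive:
  assumes "v \<noteq> []"
  shows "\<exists>t\<in>carrier RBL. \<forall>x. t (v \<frown> x) = True ## x"
  using assms
proof (induction v)
  case (Cons b v)
  define s where "s = (if b then id else flip)"
  have s: "s \<in> carrier RBL" "s (b ## x) = True ## x" for x
    by (auto simp: s_def flip_RBL id_RBL)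
  show ?case
  proof (cases "v = []")
    case True
    then show ?thesis using s by auto
  next
    case False
    then obtain t where t: "t \<in> carrier RBL" "\<And>x. t (v \<frown> x) = True ## x"
      using Cons.IH by blast
    have "thompson_x0 \<circ> s \<circ> on_cone b t \<in> carrier RBL"
      by (intro RBL_comp_closed thompson_x0_RBL s on_cone_RBL t)
    moreover have "\<forall>x. (thompson_x0 \<circ> s \<circ> on_cone b t) ((b # v) \<frown> x) = True ## x"
      using s(2) t(2) by simp
    ultimately show ?thesis by blast
  qed
qed simp

text \<open>Applies \<open>f\<close> after the first \<open>False\<close>, hence on all cones
  \<open>1^n 0\<close> at once. The recursion runs over the output position because a sequence may
  contain no \<open>False\<close>.\<close>

fun spread :: "(cantor \<Rightarrow> cantor) \<Rightarrow> cantor \<Rightarrow> cantor" where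
  "spread f x 0 = x 0"
| "spread f x (Suc n) = (if x 0 then spread f (tail x) n else f (tail x) n)"

lemma spread_scons [simp]: "spread f (b ## x) = b ## (if b then spread f x else f x)"
proof (rule ext)
  fix i
  show "spread f (b ## x) i = (b ## (if b then spread f x else f x)) i" by (cases i) auto
qed

text \<open>One state, looping on \<open>True\<close>, is added to those of \<open>f\<close>. The
  constant \<open>K\<close> of \<open>f\<close> still serves, since all letters read before
  \<open>f\<close> starts are copied.\<close>

lemma fsl_spread:
  assumes "fsl f"
  shows "fsl (spread f)"
proof -
  obtain Q where Q: "f \<in> Q" "fs_closed Q"
    using assms unfolding fsl_def finite_state_def by blast
  have "\<exists>w. \<exists>F'\<in>insert (spread f) Q. \<forall>x. F (b ## x) = w \<frown> F' x"
    if F: "F \<in> insert (spread f) Q" for F b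
  proof (cases "F \<in> Q")
    case True
    then show ?thesis using Q(2) unfolding fs_closed_def by blast
  next
    case False
    then have "F = spread f" using F by blast
    then show ?thesis using Q(1)
      by (intro exI[of _ "[b]"] bexI[of _ "if b then spread f else f"]) auto
  qed
  then have "fs_closed (insert (spread f) Q)" using Q(2) unfolding fs_closed_def by blast
  then have "finite_state (spread f)" unfolding finite_state_def by blast
  moreover obtain K where K: "\<And>n x y. agree (n + K) x y \<Longrightarrow> agree n (f x) (f y)"
    using assms unfolding fsl_def lip_def by blast
  have "agree n (spread f x) (spread f y)" if "agree (n + K) x y" for n x y
    using that
  proof (induction n arbitrary: x y)
    case (Suc n)
    obtain b x' where x: "x = b ## x'" by (rule scons_cases)
    obtain c y' where y: "y = c ## y'" by (rule scons_cases)
    show ?case using Suc K by (auto simp: x y)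
  qed simp
  then have "lip (spread f)" unfolding lip_def by blast
  ultimately show ?thesis by (simp add: fsl_def)
qed

lemma spread_comp: "spread f (spread g x) = spread (f \<circ> g) x"
proof (rule agree_imp_eq)
  fix n
  show "agree n (spread f (spread g x)) (spread (f \<circ> g) x)"
  proof (induction n arbitrary: x)
    case (Suc n)
    then show ?case by (cases x rule: scons_cases) auto
  qed simp
qed

lemma spread_id: "spread id x = x"
proof (rule agree_imp_eq)
  fix n
  show "agree n (spread id x) x"
  proof (induction n arbitrary: x)
    case (Suc n)
    then show ?case by (cases x rule: scons_cases) auto
  qed simp
qed

lemma spread_RBL:
  assumes "f \<in> carrier RBL"
  shows "spread f \<in> carrier RBL"
proof (rule RBL_I)
  have "f \<circ> finv f = id" "finv f \<circ> f = id" using assms by auto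
  then show "spread f (spread (finv f) x) = x" "spread (finv f) (spread f x) = x" for x
    by (simp_all add: spread_comp spread_id)
qed (use assms in \<open>auto simp: RBL_iff intro: fsl_spread\<close>)

text \<open>The witness \<open>g\<close> carries a copy of \<open>f\<close> on each cone \<open>1\<^sup>n0\<close> with \<open>n \<ge> 1\<close>; conjugation by
  \<open>x\<^sub>0\<close> moves each copy to its predecessor and the first one to \<open>01\<close>.\<close>

lemma on_cone_commutator:
  assumes f: "f \<in> carrier RBL"
  shows "\<exists>g\<in>carrier RBL. \<exists>h\<in>carrier RBL. on_word [False, True] f = finv g \<circ> h \<circ> g \<circ> finv h"
proof -
  define g where "g = on_cone True (spread f)"
  have g: "g \<in> carrier RBL" unfolding g_def by (intro on_cone_RBL spread_RBL f)
  \<comment> \<open>With \<open>finv g\<close> moved to the other side, the identity is checked on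
    the four cones of depth 2.\<close>
  have "g (on_word [False, True] f x) = thompson_x0 (g (finv thompson_x0 x))" for x
  proof -
    obtain b c y where "x = b ## c ## y" by (metis scons_tail)
    then show ?thesis by (cases b; cases c) (auto simp: g_def finv_thompson_x0)
  qed
  then have "on_word [False, True] f x = (finv g \<circ> thompson_x0 \<circ> g \<circ> finv thompson_x0) x" for x
    using g by (metis RBL_inv_apply(2) comp_apply)
  then show ?thesis using g thompson_x0_RBL by blast
qed

section \<open>Simplicity\<close>

text \<open>By continuity a small cone around a moved point is displaced off itself. The third cone
  \<open>v\<close> later supplies a place that a swap of the first with its image leaves
  fixed.\<close>

lemma moves_cone:
  assumes k: "k \<in> carrier RBL" "k \<noteq> id"
  shows "\<exists>u v. u \<noteq> [] \<and> v \<noteq> [] \<and> (\<forall>x y. k (u \<frown> x) \<noteq> u \<frown> y) \<and>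
    (\<forall>x y. u \<frown> x \<noteq> v \<frown> y) \<and> (\<forall>x y. k (u \<frown> x) \<noteq> v \<frown> y)"
proof -
  obtain p where "k p \<noteq> p" using k(2) by (auto simp: fun_eq_iff)
  then obtain N where N: "\<not> agree N (k p) p" by (rule not_agreeE)
  obtain K where K: "\<And>n x y. agree (n + K) x y \<Longrightarrow> agree n (k x) (k y)"
    using k(1) by (auto simp: RBL_iff fsl_def lip_def)
  \<comment> \<open>At this depth the first \<open>N + 2\<close> letters of \<open>k\<close> are
    constant on the cone: \<open>N\<close> separate \<open>k p\<close> from \<open>p\<close>, and
    two serve \<open>v\<close>, whose letter 0 avoids \<open>u\<close> and whose letter 1 avoids the
    image.\<close>
  define u where "u = map p [0..<N + 2 + K]"
  define v where "v = [\<not> p 0, \<not> k p 1]"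
  have u: "agree (N + 2 + K) (u \<frown> x) p" for x
    using agree_prefix_iff[of "u \<frown> x" p "N + 2 + K"] unfolding u_def by blast
  then have ku: "agree (N + 2) (k (u \<frown> x)) (k p)" for x by (rule K)
  have "k (u \<frown> x) \<noteq> u \<frown> y" for x y
    using N u[of y] ku[of x] by (auto simp: agree_def)
  moreover have "u \<frown> x \<noteq> v \<frown> y" for x y
  proof
    assume "u \<frown> x = v \<frown> y"
    then have "(u \<frown> x) 0 = (\<not> p 0)" by (simp add: v_def)
    then show False using u[of x] by (auto simp: agree_def)
  qed
  moreover have "k (u \<frown> x) \<noteq> v \<frown> y" for x y
  proof
    assume "k (u \<frown> x) = v \<frown> y"
    then have "k (u \<frown> x) 1 = (\<not> k p 1)" by (simp add: v_def)
    then show False using ku[of x] by (auto simp: agree_def)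
  qed
  moreover have "u \<noteq> []" "v \<noteq> []" by (simp_all add: u_def v_def)
  ultimately show ?thesis by blast
qed

lemma cone_agree:
  assumes "x \<in> range (prepend u)" "agree (length u) x y"
  shows "y \<in> range (prepend u)"
proof -
  obtain z where "x = u \<frown> z" using assms(1) by blast
  then have "map y [0..<length u] = u"
    using assms(2) by (intro nth_equalityI) (auto simp: agree_def prepend_nth)
  then show ?thesis using prefix_decomposition[of y "length u"] by (metis rangeI)
qed

text \<open>The cone and its image are disjoint, so exchanging them is an involution. Both are
  clopen, hence the branch taken is constant on each cone of depth
  \<open>length u + K\<close>.\<close>

lemma swap_cone_with_image:
  assumes k: "k \<in> carrier RBL" and disj: "\<And>x y. k (u \<frown> x) \<noteq> u \<frown> y"
  defines "g \<equiv> \<lambda>x. if x \<in> range (prepend u) then k x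
      else if finv k x \<in> range (prepend u) then finv k x else x"
  shows "g \<in> carrier RBL" and "g (g x) = x"
proof -
  show gg: "g (g x) = x" for x
    unfolding g_def using k disj by auto
  obtain K where K: "\<And>n x y. agree (n + K) x y \<Longrightarrow> agree n (finv k x) (finv k y)"
    using k by (auto simp: RBL_iff fsl_def lip_def)
  have "fsl g"
  proof (rule fsl_piecewise)
    fix w :: "bool list" assume w: "length w = length u + K"
    have 1: "w \<frown> x \<in> range (prepend u) \<longleftrightarrow> w \<frown> y \<in> range (prepend u)" for x y
      using cone_agree agree_prepend_le[of "length u" w] w by (metis le_add1)
    have "agree (length u) (finv k (w \<frown> x)) (finv k (w \<frown> y))" for x y
      using w by (intro K agree_prepend_le) simp
    then have 2: "finv k (w \<frown> x) \<in> range (prepend u) \<longleftrightarrow> finv k (w \<frown> y) \<in> range (prepend u)" for x y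
      using cone_agree by metis
    fix y :: cantor
    define h where "h = (if w \<frown> y \<in> range (prepend u) then k
      else if finv k (w \<frown> y) \<in> range (prepend u) then finv k else id)"
    have "fsl h" using k by (auto simp: h_def RBL_iff fsl_id)
    moreover have "g (w \<frown> x) = h (w \<frown> x)" for x
      unfolding g_def h_def using 1[of x y] 2[of x y] by simp
    ultimately show "\<exists>h. fsl h \<and> (\<forall>x. g (w \<frown> x) = h (w \<frown> x))" by blast
  qed
  then show "g \<in> carrier RBL" using gg by (intro RBL_I)
qed

lemma normal_RBL:
  assumes "N \<lhd> RBL"
  shows normal_RBL_subset: "N \<subseteq> carrier RBL"
    and normal_RBL_id: "id \<in> N"
    and normal_RBL_comp: "\<And>f g. f \<in> N \<Longrightarrow> g \<in> N \<Longrightarrow> f \<circ> g \<in> N"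
    and normal_RBL_inv: "\<And>f. f \<in> N \<Longrightarrow> finv f \<in> N"
    and normal_RBL_conj: "\<And>f g. f \<in> N \<Longrightarrow> g \<in> carrier RBL \<Longrightarrow> g \<circ> f \<circ> finv g \<in> N"
    and normal_RBL_conj': "\<And>f g. f \<in> N \<Longrightarrow> g \<in> carrier RBL \<Longrightarrow> finv g \<circ> f \<circ> g \<in> N"
proof -
  have sub: "subgroup N RBL" using assms by (rule normal_imp_subgroup)
  show subset: "N \<subseteq> carrier RBL" using sub by (rule subgroup.subset)
  show "id \<in> N" using subgroup.one_closed[OF sub] by simp
  show "\<And>f g. f \<in> N \<Longrightarrow> g \<in> N \<Longrightarrow> f \<circ> g \<in> N" using subgroup.m_closed[OF sub] by simp
  show "finv f \<in> N" if "f \<in> N" for f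
    using subgroup.m_inv_closed[OF sub that] that subset by auto
  show "g \<circ> f \<circ> finv g \<in> N" if "f \<in> N" "g \<in> carrier RBL" for f g
    using normal.inv_op_closed2[OF assms that(2,1)] that(2) by simp
  show "finv g \<circ> f \<circ> g \<in> N" if "f \<in> N" "g \<in> carrier RBL" for f g
    using normal.inv_op_closed1[OF assms that(2,1)] that(2) by simp
qed

text \<open>If \<open>f\<close> moves the cone of \<open>u\<close> off itself and \<open>a\<close>, \<open>b\<close> are supported on that cone, then
  \<open>[f, a]\<close> acts on the cone as \<open>a\<inverse>\<close>, hence \<open>[[f, a], b] = [a\<inverse>, b]\<close>.\<close>

lemma commutator_in_normal:
  assumes N: "N \<lhd> RBL" "f \<in> N" and disj: "\<And>x y. f (u \<frown> x) \<noteq> u \<frown> y"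
    and g: "g \<in> carrier RBL" and h: "h \<in> carrier RBL"
  shows "on_word u (finv g \<circ> h \<circ> g \<circ> finv h) \<in> N"
proof -
  have f: "f \<in> carrier RBL" using N normal_RBL_subset by blast
  define a where "a = on_word u g"
  define b where "b = on_word u h"
  have ab: "a \<in> carrier RBL" "b \<in> carrier RBL" by (simp_all add: a_def b_def on_word_RBL g h)
  have fa: "finv a = on_word u (finv g)" and fb: "finv b = on_word u (finv h)"
    by (simp_all add: a_def b_def finv_on_word g h)
  \<comment> \<open>\<open>a1\<close> and \<open>a2\<close> are inverse to each other and supported
    on the image of the cone under \<open>f\<close>, hence trivial on the cone itself.\<close>
  define a1 where "a1 = f \<circ> a \<circ> finv f"
  define a2 where "a2 = f \<circ> finv a \<circ> finv f"
  have a12: "a1 (a2 x) = x" "a2 (a1 x) = x" for x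
    using f ab by (simp_all add: a1_def a2_def)
  have "finv f (u \<frown> x) \<notin> range (prepend u)" for x
    using disj f by (metis RBL_inv_apply(1) rangeE)
  then have a1u: "a1 (u \<frown> x) = u \<frown> x" and a2u: "a2 (u \<frown> x) = u \<frown> x" for x
    unfolding a1_def a2_def fa unfolding a_def using f by (simp_all add: on_word_outside)
  define c where "c = a1 \<circ> finv a"
  \<comment> \<open>Regrouped as \<open>f\<close> times a conjugate of its inverse, the commutator
    lies in \<open>N\<close>.\<close>
  have "c = f \<circ> (a \<circ> finv f \<circ> finv a)" by (simp add: c_def a1_def comp_assoc)
  then have cN: "c \<in> N"
    using N ab(1) by (simp add: normal_RBL_comp normal_RBL_conj normal_RBL_inv)
  have finvc: "finv c = a \<circ> a2"
    by (rule inv_equality) (use ab a12 in \<open>simp_all add: c_def\<close>)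
  have "c \<circ> (b \<circ> finv c \<circ> finv b) \<in> N"
    using N(1) cN ab(2) by (simp add: normal_RBL_comp normal_RBL_conj normal_RBL_inv)
  moreover have d: "c \<circ> (b \<circ> finv c \<circ> finv b) =
    a1 \<circ> on_word u (finv g) \<circ> on_word u h \<circ> on_word u g \<circ> a2 \<circ> on_word u (finv h)"
    unfolding finvc fb unfolding c_def fa unfolding a_def b_def by (simp only: comp_assoc)
  have "(c \<circ> (b \<circ> finv c \<circ> finv b)) x = on_word u (finv g \<circ> h \<circ> g \<circ> finv h) x" for x
  proof (cases "x \<in> range (prepend u)")
    case True
    then obtain y where "x = u \<frown> y" by blast
    then show ?thesis
      unfolding d by (simp add: a1u a2u)
  next
    case False
    \<comment> \<open>As \<open>a2\<close> preserves the complement of the cone, the factors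
      supported on the cone act trivially and \<open>a1\<close>, \<open>a2\<close> cancel.\<close>
    have "a2 x \<notin> range (prepend u)"
    proof
      assume "a2 x \<in> range (prepend u)"
      then obtain y where "a2 x = u \<frown> y" by blast
      then have "x = u \<frown> y" using a12(1)[of x] a1u by simp
      then show False using False by blast
    qed
    then show ?thesis
      using False unfolding d by (simp add: on_word_outside a12)
  qed
  ultimately show ?thesis by (metis ext)
qed

lemma simple_grp_RBL: "simple_grp RBL"
  unfolding simple_grp_def
proof (intro conjI allI impI)
  show "group RBL" by (rule group_RBL)
  have "flip (\<lambda>_. True) \<noteq> id (\<lambda>_. True)" by (metis flip_def id_apply scons_0)
  then have "flip \<noteq> id" by metis
  then show "carrier RBL \<noteq> {\<one>\<^bsub>RBL\<^esub>}" using flip_RBL by auto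
next
  fix N assume N: "N \<lhd> RBL"
  show "N = carrier RBL \<or> N = {\<one>\<^bsub>RBL\<^esub>}"
  proof (rule disjCI)
    assume "N \<noteq> {\<one>\<^bsub>RBL\<^esub>}"
    then obtain f where f: "f \<in> N" "f \<noteq> id" using normal_RBL_id[OF N] by auto
    then have "f \<in> carrier RBL" using normal_RBL_subset[OF N] by blast
    then obtain u where u: "\<And>x y. f (u \<frown> x) \<noteq> u \<frown> y" using moves_cone[OF _ f(2)] by blast
    have "on_word (u @ [False, True]) h \<in> N" if h: "h \<in> carrier RBL" for h
    proof -
      obtain g1 g2 where "g1 \<in> carrier RBL" "g2 \<in> carrier RBL"
        "on_word [False, True] h = finv g1 \<circ> g2 \<circ> g1 \<circ> finv g2"
        using on_cone_commutator[OF h] by blast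
      then show ?thesis
        using commutator_in_normal[OF N f(1) u] by (metis on_word_append)
    qed
    moreover obtain t where t: "t \<in> carrier RBL"
      "\<And>x. t ((u @ [False, True]) \<frown> x) = True ## x"
      using cone_transitive[of "u @ [False, True]"] by blast
    \<comment> \<open>The target is \<open>[False]\<close> because elements fixing the half
      \<open>[True]\<close> pointwise live there.\<close>
    define s where "s = flip \<circ> t"
    have s: "s \<in> carrier RBL" unfolding s_def by (intro RBL_comp_closed flip_RBL t)
    have "s ((u @ [False, True]) \<frown> x) = [False] \<frown> x" for x
      using t(2)[of x] by (simp add: s_def)
    ultimately have on_False: "on_cone False h \<in> N" if "h \<in> carrier RBL" for h
      using normal_RBL_conj[OF N _ s] conj_on_word[OF s, of "u @ [False, True]" "[False]" h] that
      by (metis on_word.simps)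
    \<comment> \<open>Conjugation moves the fixed cone to the half \<open>[True]\<close>, leaving an
      element of the form \<open>on_cone False h\<close>.\<close>
    have fixing: "k \<in> N" if k: "k \<in> carrier RBL" and "v \<noteq> []" and kv: "\<And>x. k (v \<frown> x) = v \<frown> x" for k v
    proof -
      obtain t where t: "t \<in> carrier RBL" "\<And>x. t (v \<frown> x) = True ## x"
        using cone_transitive[OF \<open>v \<noteq> []\<close>] by blast
      define k' where "k' = t \<circ> k \<circ> finv t"
      have "k' \<in> carrier RBL" unfolding k'_def by (intro RBL_comp_closed RBL_inv_closed t k)
      moreover have "k' (True ## x) = True ## x" for x
        using t(1) kv by (simp add: k'_def flip: t(2))
      ultimately have "k' \<in> N" using fixes_cone_imp_on_cone on_False by blast
      then have "finv t \<circ> k' \<circ> t \<in> N" using normal_RBL_conj'[OF N _ t(1)] by blast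
      moreover have "finv t \<circ> k' \<circ> t = k" using t(1) by (auto simp: k'_def)
      ultimately show ?thesis by simp
    qed
    have "k \<in> N" if k: "k \<in> carrier RBL" for k
    proof (cases "k = id")
      case True
      then show ?thesis using normal_RBL_id[OF N] by simp
    next
      case False
      then obtain u v where uv: "u \<noteq> []" "v \<noteq> []" "\<And>x y. k (u \<frown> x) \<noteq> u \<frown> y"
        "\<And>x y. u \<frown> x \<noteq> v \<frown> y" "\<And>x y. k (u \<frown> x) \<noteq> v \<frown> y"
        using moves_cone[OF k] by metis
      \<comment> \<open>The involution \<open>g\<close> fixes the cone of \<open>v\<close> and
        undoes \<open>k\<close> on the cone of \<open>u\<close>; so \<open>g\<close> and
        \<open>g \<circ> k\<close> both fix a cone, and
        \<open>k = g \<circ> (g \<circ> k)\<close>.\<close>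
      define g where "g = (\<lambda>x. if x \<in> range (prepend u) then k x
        else if finv k x \<in> range (prepend u) then finv k x else x)"
      have g: "g \<in> carrier RBL" "\<And>x. g (g x) = x"
        unfolding g_def by (rule swap_cone_with_image[OF k uv(3)])+
      have "finv k (v \<frown> x) \<notin> range (prepend u)" for x
        using uv(5) k by (metis RBL_inv_apply(1) rangeE)
      then have "g (v \<frown> x) = v \<frown> x" for x
        using uv(4) by (auto simp: g_def) metis
      then have "g \<in> N" using fixing g(1) uv(2) by blast
      moreover have "(g \<circ> k) (u \<frown> x) = u \<frown> x" for x
        using uv(3) k by (auto simp: g_def)
      then have "g \<circ> k \<in> N" using fixing RBL_comp_closed[OF g(1) k] uv(1) by blast
      ultimately have "g \<circ> (g \<circ> k) \<in> N" using normal_RBL_comp[OF N] by blast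
      moreover have "g \<circ> (g \<circ> k) = k" using g(2) by auto
      ultimately show ?thesis by simp
    qed
    then show "N = carrier RBL" using normal_RBL_subset[OF N] by blast
  qed
qed

section \<open>Infinite generation\<close>

lemma prepend_power:
  assumes "\<And>a. F (s \<frown> a) = z \<frown> F a"
  shows "F (concat (replicate k s) \<frown> a) = concat (replicate k z) \<frown> F a"
  using assms by (induction k) auto

lemma linear_bound_imp_le:
  fixes m n c :: nat
  assumes "\<And>k. k * m \<le> k * n + c"
  shows "m \<le> n"
proof (rule ccontr)
  assume "\<not> m \<le> n"
  then have "Suc c * Suc n \<le> Suc c * m" by (intro mult_le_mono) auto
  also have "\<dots> \<le> Suc c * n + c" by (rule assms)
  finally show False by simp
qed

text \<open>Running the cycle \<open>k\<close> times, the Lipschitz condition on \<open>f\<close>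
  bounds \<open>k * length s\<close> by \<open>k * length z\<close> plus a constant, and the one on
  \<open>finv f\<close> gives the converse.\<close>

lemma cycle_output_length:
  assumes f: "f \<in> carrier RBL" and v: "\<And>a. f (v \<frown> a) = v' \<frown> F a"
    and s: "\<And>a. F (s \<frown> a) = z \<frown> F a"
  shows "length s = length z"
proof -
  obtain K where K: "\<And>n x y. agree (n + K) x y \<Longrightarrow> agree n (f x) (f y)"
    using f by (auto simp: RBL_iff fsl_def lip_def)
  obtain L where L: "\<And>n x y. agree (n + L) x y \<Longrightarrow> agree n (finv f x) (finv f y)"
    using f by (auto simp: RBL_iff fsl_def lip_def)
  have injf: "inj f" using f by (simp add: RBL_iff bij_is_inj)
  define p where "p k = v @ concat (replicate k s)" for k
  define r where "r k = v' @ concat (replicate k z)" for k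
  have len: "length (p k) = length v + k * length s" "length (r k) = length v' + k * length z" for k
    by (simp_all add: p_def r_def length_concat sum_list_replicate)
  have run: "f (p k \<frown> a) = r k \<frown> F a" for k a
    using prepend_power[of F s z k a, OF s] v by (simp add: p_def r_def)
  \<comment> \<open>Tails that differ at once, with values under \<open>F\<close> that differ within
    \<open>d\<close> letters, convert the Lipschitz conditions into bounds on word lengths.\<close>
  define a b :: cantor where "a = (\<lambda>_. True)" and "b = (\<lambda>_. False)"
  have ab: "\<not> agree 1 a b" by (simp add: a_def b_def agree_def)
  have "F a \<noteq> F b"
  proof
    assume "F a = F b"
    then have "f (v \<frown> a) = f (v \<frown> b)" by (simp add: v)
    then have "a = b" using injf by (simp add: inj_eq)
    then show False using ab by simp
  qed
  then obtain d where d: "\<not> agree d (F a) (F b)" by (rule not_agreeE)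
  have "length (p k) \<le> length (r k) + d + K" for k
  proof (rule ccontr)
    assume "\<not> length (p k) \<le> length (r k) + d + K"
    then have "agree (length (r k) + d + K) (p k \<frown> a) (p k \<frown> b)"
      by (intro agree_prepend_le) simp
    then have "agree (length (r k) + d) (f (p k \<frown> a)) (f (p k \<frown> b))" by (rule K)
    then show False using d by (simp add: run)
  qed
  then have "k * length s \<le> k * length z + (length v' + d + K)" for k
    using len[of k] by (metis (no_types, lifting) add.assoc add.commute add_leD1)
  then have "length s \<le> length z" by (rule linear_bound_imp_le)
  moreover have "length (r k) \<le> length (p k) + 1 + L" for k
  proof (rule ccontr)
    assume "\<not> length (r k) \<le> length (p k) + 1 + L"
    then have "agree (length (p k) + 1 + L) (r k \<frown> F a) (r k \<frown> F b)"
      by (intro agree_prepend_le) simp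
    then have "agree (length (p k) + 1) (finv f (f (p k \<frown> a))) (finv f (f (p k \<frown> b)))"
      unfolding run by (rule L)
    then have "agree (length (p k) + 1) (p k \<frown> a) (p k \<frown> b)" using f by simp
    then show False using ab unfolding agree_prepend by blast
  qed
  then have "k * length z \<le> k * length s + (length v + 1 + L)" for k
    using len[of k] by (metis (no_types, lifting) add.assoc add.commute add_leD1)
  then have "length z \<le> length s" by (rule linear_bound_imp_le)
  ultimately show ?thesis by simp
qed

definition coprime_periodic :: "nat \<Rightarrow> cantor \<Rightarrow> bool" where
  "coprime_periodic q x \<longleftrightarrow> (\<exists>u w y. x = u \<frown> y \<and> y = w \<frown> y \<and> w \<noteq> [] \<and> coprime (length w) q)"

text \<open>A map with fewer than \<open>q\<close> states returns to some state after reading the period a number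
  \<open>c < q\<close> of times, and the output produced meanwhile is as long as the input.\<close>

lemma coprime_periodic_preserved:
  assumes f: "f \<in> carrier RBL"
  shows "\<exists>n. \<forall>q>n. prime q \<longrightarrow> (\<forall>x. coprime_periodic q x \<longrightarrow> coprime_periodic q (f x))"
proof -
  obtain Q where Q: "f \<in> Q" "fs_closed Q"
    using f by (auto simp: RBL_iff fsl_def finite_state_def)
  have finQ: "finite Q" using Q(2) unfolding fs_closed_def by blast
  have "coprime_periodic q (f x)" if q: "prime q" "card Q < q" and x: "coprime_periodic q x" for q x
  proof -
    obtain u w y where uwy: "x = u \<frown> y" "y = w \<frown> y" "w \<noteq> []" "coprime (length w) q"
      using x unfolding coprime_periodic_def by blast
    \<comment> \<open>The period \<open>w\<close> is treated as a single letter, with transition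
      \<open>d\<close> and output \<open>out\<close>.\<close>
    have "\<forall>F. \<exists>z G. F \<in> Q \<longrightarrow> G \<in> Q \<and> (\<forall>a. F (w \<frown> a) = z \<frown> G a)"
      using fs_closed_word[OF Q(2)] by blast
    then obtain out d where
      d: "\<And>F. F \<in> Q \<Longrightarrow> d F \<in> Q \<and> (\<forall>a. F (w \<frown> a) = out F \<frown> d F a)" by metis
    obtain v0 F0 where F0: "F0 \<in> Q" "\<And>a. f (u \<frown> a) = v0 \<frown> F0 a"
      using fs_closed_word[OF Q(2,1)] by blast
    define G where "G k = (d ^^ k) F0" for k
    have GQ: "G k \<in> Q" for k by (induction k) (use d F0 in \<open>auto simp: G_def\<close>)
    have step: "\<exists>z. \<forall>a. G k (concat (replicate c w) \<frown> a) = z \<frown> G (k + c) a" for k c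
    proof (induction c arbitrary: k)
      case 0
      then show ?case by (auto intro: exI[of _ "[]"])
    next
      case (Suc c)
      obtain z where z: "\<And>a. G (Suc k) (concat (replicate c w) \<frown> a) = z \<frown> G (Suc k + c) a"
        using Suc by blast
      have "G k (w \<frown> a) = out (G k) \<frown> G (Suc k) a" for a
        using d[OF GQ] by (simp add: G_def)
      then have "\<forall>a. G k (concat (replicate (Suc c) w) \<frown> a) = (out (G k) @ z) \<frown> G (k + Suc c) a"
        using z by simp
      then show ?case by blast
    qed
    \<comment> \<open>There is one more index than there are states.\<close>
    have "\<not> inj_on G {0..card Q}"
      using card_inj_on_le[of G "{0..card Q}" Q] GQ finQ by auto
    then obtain i c where ic: "G i = G (i + c)" "0 < c" "c \<le> card Q"
    proof -
      assume *: thesis if "G i = G (i + c)" "0 < c" "c \<le> card Q" for i c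
      obtain i j where "G i = G j" "i \<noteq> j" "i \<le> card Q" "j \<le> card Q"
        using \<open>\<not> inj_on G {0..card Q}\<close> unfolding inj_on_def by auto
      then show thesis
        using *[of i "j - i"] *[of j "i - j"] by (cases i j rule: linorder_cases) auto
    qed
    define F where "F = G i"
    obtain z0 where z0: "\<And>a. F0 (concat (replicate i w) \<frown> a) = z0 \<frown> F a"
      using step[of 0 i] by (auto simp: G_def F_def)
    obtain z where z: "\<And>a. F (concat (replicate c w) \<frown> a) = z \<frown> F a"
      using step[of i c] ic(1) by (auto simp: F_def)
    have wy: "concat (replicate k w) \<frown> y = y" for k
      by (induction k) (use uwy(2) in auto)
    have fx: "f x = (v0 @ z0) \<frown> F y"
      using F0(2)[of y] z0[of y] by (simp add: uwy(1) wy)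
    have Fy: "F y = z \<frown> F y" using z[of y] by (simp add: wy)
    have "f ((u @ concat (replicate i w)) \<frown> a) = (v0 @ z0) \<frown> F a" for a
      using F0(2) z0 by simp
    then have "length (concat (replicate c w)) = length z"
      using z by (rule cycle_output_length[OF f])
    then have len: "length z = c * length w"
      by (simp add: length_concat sum_list_replicate)
    then have "z \<noteq> []" using ic(2) uwy(3) by auto
    moreover have "coprime c q"
      using q ic(2,3) by (metis coprime_commute le_less_trans nat_dvd_not_less prime_imp_coprime)
    then have "coprime (length z) q" using uwy(4) len by simp
    ultimately show ?thesis using fx Fy unfolding coprime_periodic_def by blast
  qed
  then show ?thesis by blast
qed

text \<open>The phase \<open>j\<close> grows by one with each letter read and matters only modulo
  \<open>q\<close>, so the phases below \<open>q\<close> serve as states.\<close>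

definition xor_multiples :: "nat \<Rightarrow> nat \<Rightarrow> cantor \<Rightarrow> cantor" where
  "xor_multiples q j x = (\<lambda>i. x i \<noteq> (q dvd i + j))"

lemma xor_multiples_RBL:
  assumes "q > 0"
  shows "xor_multiples q j \<in> carrier RBL"
proof -
  have per: "xor_multiples q j = xor_multiples q (j mod q)" for j
    by (auto simp: xor_multiples_def fun_eq_iff dvd_eq_mod_eq_0 mod_add_right_eq)
  let ?Q = "xor_multiples q ` {..<q}"
  have in_Q: "xor_multiples q j \<in> ?Q" for j
    using per[of j] assms by (intro image_eqI[of _ _ "j mod q"]) auto
  have "xor_multiples q j (b ## x) = [b \<noteq> (q dvd j)] \<frown> xor_multiples q (Suc j) x" for j b x
  proof (rule ext)
    fix i
    show "xor_multiples q j (b ## x) i = ([b \<noteq> (q dvd j)] \<frown> xor_multiples q (Suc j) x) i"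
      by (cases i) (auto simp: xor_multiples_def)
  qed
  then have "\<exists>w. \<exists>F'\<in>?Q. \<forall>x. xor_multiples q j (b ## x) = w \<frown> F' x" for j b
    using in_Q[of "Suc j"] by (intro exI[of _ "[b \<noteq> (q dvd j)]"] bexI[of _ "xor_multiples q (Suc j)"]) simp_all
  then have "fs_closed ?Q" unfolding fs_closed_def by auto
  then have "finite_state (xor_multiples q j)" using in_Q unfolding finite_state_def by blast
  moreover have "lip (xor_multiples q j)"
    unfolding lip_def by (intro exI[of _ 0]) (auto simp: agree_def xor_multiples_def)
  ultimately have fsl: "fsl (xor_multiples q j)" by (simp add: fsl_def)
  have invol: "xor_multiples q j (xor_multiples q j x) = x" for x
    by (auto simp: xor_multiples_def)
  show ?thesis by (rule RBL_I(1)[OF fsl fsl invol invol])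
qed

text \<open>Past the preperiod, adding the period takes a multiple of \<open>q\<close> to a multiple
  of \<open>q\<close>, so \<open>q\<close> divides every period.\<close>

lemma multiples_not_coprime_periodic:
  assumes "prime q"
  shows "\<not> coprime_periodic q (\<lambda>i. q dvd i)"
proof
  assume "coprime_periodic q (\<lambda>i. q dvd i)"
  then obtain u w y where uwy: "(\<lambda>i. q dvd i) = u \<frown> y" "y = w \<frown> y" "coprime (length w) q"
    unfolding coprime_periodic_def by blast
  have y: "y i \<longleftrightarrow> q dvd length u + i" for i
    using fun_cong[OF uwy(1), of "length u + i"] by simp
  have shift: "y (length w + i) = y i" for i
    using prepend_nth_add[of w y i] uwy(2) by simp
  \<comment> \<open>\<open>q * length u\<close> is a multiple of \<open>q\<close> beyond the
    preperiod.\<close>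
  have "length u \<le> q * length u" using prime_gt_0_nat[OF assms] by simp
  then obtain i where i: "q dvd length u + i" by (metis dvd_triv_left le_Suc_ex)
  then have "q dvd length w + (length u + i)"
    using shift[of i] by (simp add: y ac_simps)
  then have "q dvd length w" using i by (simp add: dvd_add_left_iff)
  then show False using uwy(3) assms by (metis coprime_absorb_right not_prime_unit)
qed

lemma not_finitely_generated_RBL: "\<not> finitely_generated RBL"
proof
  assume "finitely_generated RBL"
  then obtain A where A: "finite A" "A \<subseteq> carrier RBL" "generate RBL A = carrier RBL"
    unfolding finitely_generated_def by blast
  \<comment> \<open>Inverses of generators occur in \<open>generate\<close> and need bounds of their
    own.\<close>
  let ?B = "A \<union> finv ` A"
  have B: "finite ?B" "?B \<subseteq> carrier RBL" using A RBL_inv_closed by auto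
  then have "\<forall>f\<in>?B. \<exists>n. \<forall>q>n. prime q \<longrightarrow> (\<forall>x. coprime_periodic q x \<longrightarrow> coprime_periodic q (f x))"
    using coprime_periodic_preserved by blast
  then obtain n where n: "\<And>f q x. f \<in> ?B \<Longrightarrow> n f < q \<Longrightarrow> prime q \<Longrightarrow>
      coprime_periodic q x \<Longrightarrow> coprime_periodic q (f x)"
    by metis
  obtain q where q: "prime q" "(\<Sum>f\<in>?B. n f) < q" using bigger_prime by blast
  have gen: "coprime_periodic q (f x)" if "f \<in> ?B" "coprime_periodic q x" for f x
    using n[OF that(1) _ q(1) that(2)] member_le_sum[OF that(1), of n] B(1) q(2) by fastforce
  have preserved: "coprime_periodic q (f x)" if "f \<in> generate RBL A" "coprime_periodic q x" for f x
    using that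
  proof (induction arbitrary: x rule: generate.induct)
    case (inv f)
    then have "inv\<^bsub>RBL\<^esub> f = finv f" using A(2) by auto
    then show ?case using inv gen by auto
  qed (auto intro: gen)
  \<comment> \<open>The zero sequence has period 1; its image under \<open>xor_multiples q 0\<close>
    is the characteristic sequence of the multiples of \<open>q\<close>.\<close>
  have "(\<lambda>_. False) = [False] \<frown> (\<lambda>_. False)" by (auto simp: fun_eq_iff scons_def split: nat.split)
  then have "coprime_periodic q (\<lambda>_. False)"
    unfolding coprime_periodic_def
    by (intro exI[of _ "[]"] exI[of _ "[False]"] exI[of _ "\<lambda>_. False"]) auto
  moreover have "xor_multiples q 0 \<in> generate RBL A"
    unfolding A(3) by (intro xor_multiples_RBL prime_gt_0_nat q)
  ultimately have "coprime_periodic q (xor_multiples q 0 (\<lambda>_. False))" using preserved by blast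
  then show False using multiples_not_coprime_periodic[OF q(1)] by (simp add: xor_multiples_def)
qed

theorem theorem0p2:
  shows "simple_grp RBL \<and> \<not> finitely_generated RBL"
  using simple_grp_RBL not_finitely_generated_RBL ..

end
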